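(* Consider a finite MDP with state space $\mathcal S$, action space $\mathcal A$, discount factor $\gamma\neq0$ (with $\gamma=1$ allowed, i.e. $\gamma\in(0,1]$), regularization $\lambda>0$, known terminal reward $g:\mathcal S\to\mathbb R$ and initial state $s_0\in\mathcal S$. Suppose the MDP is deterministic, that is, $\mathcal T(s'|s,a)\in\{0,1\}$, and one of the following holds: (i) the underlying Markov chain is irreducible and aperiodic (i.e. with randomly chosen actions, the underlying Markov chain is irreducible and aperiodic); (ii) the initial state $s_0$ admits a self-loop (i.e. it is possible to transition from this state to itself), and all states can be accessed from the initial state in at most $d$ transitions; (iii) there exist cycles starting at the initial state $s_0$ with lengths $R,R'$ such that $\gcd(R,R')=1$, and all states can be accessed from the initial state in at most $d$ transitions. Then there exists a horizon $T$ such that the time-homogeneous IRL problem is well posed. In particular, in case (ii) it is sufficient to take any finite $T\ge d+1$; in case (iii) it is sufficient to take any finite $T\ge d+RR'$.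
   Context: A transition $s\to s'$ is possible if $\mathcal T(s'|s,a)>0$ for some $a\in\mathcal A$. A cycle is a sequence of possible transitions which start and end in the same state; its length is the number of transitions. An irreducible Markov chain is aperiodic if there is no common factor (greater than one) of the lengths of all cycles. Finite-horizon entropy-regularized MDP: for a time-homogeneous running reward $f:\mathcal S\times\mathcal A\to\mathbb R$ and terminal reward $g$, set $V^*_T=g$ and, for $t=T-1,\dots,0$, $$Q^*_t(s,a)=f(s,a)+\gamma\sum_{s'}\mathcal T(s'|s,a)V^*_{t+1}(s'),\quad V^*_t(s)=\lambda\log\sum_{a}\exp(Q^*_t(s,a)/\lambda),\quad \pi^*_t(a|s)=\exp\big((Q^*_t(s,a)-V^*_t(s))/\lambda\big).$$ Well-posedness: the time-homogeneous IRL problem (at horizon $T$, with initial state $s_0$) is well posed if knowledge of the (time-dependent) entropy-regularized optimal strategy $\pi^*_t(a|s)$ and of the terminal reward $g$ (with $\mathcal T,\gamma,\lambda$ known) is sufficient to uniquely determine a time-homogeneous running reward $f$, if it exists, up to a constant. *)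

theory Defs
  imports "HOL-Probability.Probability_Mass_Function"
begin

text \<open>
  An MDP with finitely many states and actions is given by its transition kernel
  \<open>K :: 's \<Rightarrow> 'a \<Rightarrow> 's pmf\<close>, where \<open>pmf (K s a) s'\<close> is the probability of moving from \<open>s\<close>
  to \<open>s'\<close> under action \<open>a\<close>.
\<close>

definition deterministic :: "('s \<Rightarrow> 'a \<Rightarrow> 's pmf) \<Rightarrow> bool" where
  "deterministic K \<longleftrightarrow> (\<forall>s a s'. pmf (K s a) s' \<in> {0, 1})"

definition possible :: "('s \<Rightarrow> 'a \<Rightarrow> 's pmf) \<Rightarrow> 's \<Rightarrow> 's \<Rightarrow> bool" where
  "possible K s s' \<longleftrightarrow> (\<exists>a. pmf (K s a) s' > 0)"

text \<open>
  Below, \<open>(possible K ^^ n) s s'\<close> says that \<open>s'\<close> is reached from \<open>s\<close> by a sequence of exactly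
  \<open>n\<close> possible transitions. The empty sequence does not count as a cycle.
\<close>

definition cycle_at :: "('s \<Rightarrow> 'a \<Rightarrow> 's pmf) \<Rightarrow> 's \<Rightarrow> nat \<Rightarrow> bool" where
  "cycle_at K s n \<longleftrightarrow> n \<ge> 1 \<and> (possible K ^^ n) s s"

definition irreducible_chain :: "('s \<Rightarrow> 'a \<Rightarrow> 's pmf) \<Rightarrow> bool" where
  "irreducible_chain K \<longleftrightarrow> (\<forall>s s'. \<exists>n. (possible K ^^ n) s s')"

definition aperiodic_chain :: "('s \<Rightarrow> 'a \<Rightarrow> 's pmf) \<Rightarrow> bool" where
  "aperiodic_chain K \<longleftrightarrow> \<not> (\<exists>m>1. \<forall>s n. cycle_at K s n \<longrightarrow> m dvd n)"

definition all_accessible_within :: "('s \<Rightarrow> 'a \<Rightarrow> 's pmf) \<Rightarrow> 's \<Rightarrow> nat \<Rightarrow> bool" where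
  "all_accessible_within K s0 d \<longleftrightarrow> (\<forall>s. \<exists>n\<le>d. (possible K ^^ n) s0 s)"

text \<open>The entropy-regularized Bellman recursion, with \<open>W\<close> the value function one step ahead.\<close>

definition bellman_Q ::
  "('s::finite \<Rightarrow> 'a \<Rightarrow> 's pmf) \<Rightarrow> real \<Rightarrow> ('s \<Rightarrow> 'a \<Rightarrow> real) \<Rightarrow> ('s \<Rightarrow> real) \<Rightarrow> 's \<Rightarrow> 'a \<Rightarrow> real" where
  "bellman_Q K \<gamma> f W s a = f s a + \<gamma> * (\<Sum>s'\<in>UNIV. pmf (K s a) s' * W s')"

function opt_V ::
  "('s::finite \<Rightarrow> 'a::finite \<Rightarrow> 's pmf) \<Rightarrow> real \<Rightarrow> real \<Rightarrow> ('s \<Rightarrow> real) \<Rightarrow> nat \<Rightarrow>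
   ('s \<Rightarrow> 'a \<Rightarrow> real) \<Rightarrow> nat \<Rightarrow> 's \<Rightarrow> real" where
  "opt_V K \<gamma> lam g T f t s =
     (if t < T
      then lam * ln (\<Sum>a\<in>UNIV. exp (bellman_Q K \<gamma> f (opt_V K \<gamma> lam g T f (Suc t)) s a / lam))
      else g s)"
  by pat_completeness auto
termination
  by (relation "Wellfounded.measure (\<lambda>(K, \<gamma>, lam, g, T, f, t, s). T - t)") auto

declare opt_V.simps [simp del]

definition opt_Q ::
  "('s::finite \<Rightarrow> 'a::finite \<Rightarrow> 's pmf) \<Rightarrow> real \<Rightarrow> real \<Rightarrow> ('s \<Rightarrow> real) \<Rightarrow> nat \<Rightarrow>
   ('s \<Rightarrow> 'a \<Rightarrow> real) \<Rightarrow> nat \<Rightarrow> 's \<Rightarrow> 'a \<Rightarrow> real" where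
  "opt_Q K \<gamma> lam g T f t = bellman_Q K \<gamma> f (opt_V K \<gamma> lam g T f (Suc t))"

definition opt_policy ::
  "('s::finite \<Rightarrow> 'a::finite \<Rightarrow> 's pmf) \<Rightarrow> real \<Rightarrow> real \<Rightarrow> ('s \<Rightarrow> real) \<Rightarrow> nat \<Rightarrow>
   ('s \<Rightarrow> 'a \<Rightarrow> real) \<Rightarrow> nat \<Rightarrow> 's \<Rightarrow> 'a \<Rightarrow> real" where
  "opt_policy K \<gamma> lam g T f t s a =
     exp ((opt_Q K \<gamma> lam g T f t s a - opt_V K \<gamma> lam g T f t s) / lam)"

text \<open>
  The data are \<open>K\<close>, \<open>\<gamma>\<close>, \<open>lam\<close>, the terminal reward \<open>g\<close> and the optimal policy in all states at
  the decision times \<open>t < T\<close>. Any two running rewards compatible with these data must differ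
  by a constant; nothing is required if no time-homogeneous reward generates the policy.
\<close>

definition IRL_well_posed ::
  "('s::finite \<Rightarrow> 'a::finite \<Rightarrow> 's pmf) \<Rightarrow> real \<Rightarrow> real \<Rightarrow> ('s \<Rightarrow> real) \<Rightarrow> nat \<Rightarrow> bool" where
  "IRL_well_posed K \<gamma> lam g T \<longleftrightarrow>
     (\<forall>(p :: nat \<Rightarrow> 's \<Rightarrow> 'a \<Rightarrow> real) f f'.
        (\<forall>t<T. \<forall>s a. opt_policy K \<gamma> lam g T f t s a = p t s a) \<and>
        (\<forall>t<T. \<forall>s a. opt_policy K \<gamma> lam g T f' t s a = p t s a) \<longrightarrow>
        (\<exists>c. \<forall>s a. f' s a = f s a + c))"

end

theory Submission
  imports Defs "HOL-Number_Theory.Cong"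
begin

text \<open>
  Let \<open>D\<^sub>t\<close> be the difference at time \<open>t\<close> of the value functions of two rewards \<open>f\<close>, \<open>f'\<close>
  generating the same policy, so that \<open>D\<^sub>T = 0\<close>. Equality of the policies gives
  \<open>f s a - f' s a + \<gamma> * D\<^sub>t\<^sub>+\<^sub>1 s' = D\<^sub>t s\<close> along every transition from \<open>s\<close> to \<open>s'\<close>. At the last
  decision time this says that \<open>f - f'\<close> equals \<open>D\<^sub>T\<^sub>-\<^sub>1\<close>, independently of the action; subtracting
  consecutive times shows that \<open>E\<^sub>t = D\<^sub>t - D\<^sub>t\<^sub>+\<^sub>1\<close> satisfies \<open>E\<^sub>t s = \<gamma> * E\<^sub>t\<^sub>+\<^sub>1 s'\<close>. Hence if every state
  is reached from \<open>s0\<close> in exactly \<open>N < T\<close> transitions, \<open>\<gamma>^N * E\<^sub>T\<^sub>-\<^sub>1 x\<close> does not depend on \<open>x\<close>,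
  and \<open>f - f'\<close> is constant. A self-loop is the case \<open>R = R' = 1\<close> of two coprime cycles, which
  give \<open>N = d + R * R' - 1\<close>; an irreducible aperiodic chain has at each state cycles of two
  consecutive lengths.
\<close>

text \<open>A 0-1 kernel puts its whole unit mass on one successor, so the expectation of
  \<open>W\<close> collapses to a single value.\<close>

lemma deterministic_possible_sum:
  fixes K :: "'s::finite \<Rightarrow> 'a \<Rightarrow> 's pmf"
  assumes "deterministic K" and "possible K s s'"
  obtains a where "\<And>W :: 's \<Rightarrow> real. (\<Sum>x\<in>UNIV. pmf (K s a) x * W x) = W s'"
proof -
  obtain a where "pmf (K s a) s' = 1"
    using assms unfolding deterministic_def possible_def
    by (metis insertE less_irrefl singletonD)
  moreover have "sum (pmf (K s a)) UNIV = 1"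
    by (rule sum_pmf_eq_1) auto
  ultimately have "sum (pmf (K s a)) (UNIV - {s'}) = 0"
    by (simp add: sum_diff1)
  then have "\<forall>x\<in>UNIV - {s'}. pmf (K s a) x = 0"
    by (subst (asm) sum_nonneg_eq_0_iff) auto
  then have "pmf (K s a) x = (if x = s' then 1 else 0)" for x
    using \<open>pmf (K s a) s' = 1\<close> by auto
  then have "(\<Sum>x\<in>UNIV. pmf (K s a) x * W x) = W s'" for W :: "'s \<Rightarrow> real"
    by (simp add: if_distrib[of "\<lambda>u. u * _"] cong: if_cong)
  then show thesis by (rule that)
qed

lemma well_posed_if_exactly_accessible:
  fixes K :: "'s::finite \<Rightarrow> 'a::finite \<Rightarrow> 's pmf"
  assumes "\<gamma> \<noteq> 0" and "lam \<noteq> 0" and det: "deterministic K"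
    and acc: "\<And>s. (possible K ^^ N) s0 s" and "N < T"
  shows "IRL_well_posed K \<gamma> lam g T"
  unfolding IRL_well_posed_def
proof (intro allI impI, elim conjE)
  fix p :: "nat \<Rightarrow> 's \<Rightarrow> 'a \<Rightarrow> real" and f f' :: "'s \<Rightarrow> 'a \<Rightarrow> real"
  assume p: "\<forall>t<T. \<forall>s a. opt_policy K \<gamma> lam g T f t s a = p t s a"
    and p': "\<forall>t<T. \<forall>s a. opt_policy K \<gamma> lam g T f' t s a = p t s a"
  define D where "D = (\<lambda>t s. opt_V K \<gamma> lam g T f t s - opt_V K \<gamma> lam g T f' t s)"
  have D_T: "D T s = 0" for s
    by (simp add: D_def opt_V.simps)
  have step: "f s a - f' s a + \<gamma> * (\<Sum>x\<in>UNIV. pmf (K s a) x * D (Suc t) x) = D t s"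
    if "t < T" for t s a
  proof -
    have "opt_policy K \<gamma> lam g T f t s a = opt_policy K \<gamma> lam g T f' t s a"
      using p p' that by simp
    then have "opt_Q K \<gamma> lam g T f t s a - opt_V K \<gamma> lam g T f t s
             = opt_Q K \<gamma> lam g T f' t s a - opt_V K \<gamma> lam g T f' t s"
      using \<open>lam \<noteq> 0\<close> by (simp add: opt_policy_def)
    then show ?thesis
      by (simp add: opt_Q_def bellman_Q_def D_def sum_subtractf algebra_simps)
  qed
  have last: "f s a - f' s a = D (T - 1) s" for s a
    using step[of "T - 1" s a] \<open>N < T\<close> by (simp add: D_T)
  define E where "E = (\<lambda>t s. D t s - D (Suc t) s)"
  have E_step: "E t s = \<gamma> * E (Suc t) s'" if "possible K s s'" "Suc t < T" for t s s'
  proof -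
    obtain a where a: "\<And>W :: 's \<Rightarrow> real. (\<Sum>x\<in>UNIV. pmf (K s a) x * W x) = W s'"
      using deterministic_possible_sum[OF det \<open>possible K s s'\<close>] by blast
    show ?thesis
      using step[of t s a] step[of "Suc t" s a] that
      unfolding a E_def right_diff_distrib by simp
  qed
  have E_path: "E t s = \<gamma> ^ k * E (t + k) x" if "(possible K ^^ k) s x" "t + k < T" for k s t x
    using that
  proof (induction k arbitrary: s t)
    case (Suc k)
    then obtain y where "possible K s y" "(possible K ^^ k) y x"
      by (blast elim: relpowp_Suc_E2)
    then show ?case
      using Suc.IH[of y "Suc t"] Suc.prems E_step[of s y t] by simp
  qed simp
  \<comment> \<open>Started at time \<open>T - 1 - N\<close>, the \<open>N\<close> transitions from
    \<open>s0\<close> to \<open>x\<close> end exactly at the last decision time, where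
    \<open>E\<close> equals \<open>D\<close> because \<open>D T\<close> vanishes.\<close>
  have "\<gamma> ^ N * D (T - 1) x = E (T - 1 - N) s0" for x
    using E_path[OF acc, of "T - 1 - N" x] \<open>N < T\<close> by (simp add: E_def D_T)
  then have "\<gamma> ^ N * D (T - 1) x = \<gamma> ^ N * D (T - 1) s0" for x
    by simp
  then have "D (T - 1) x = D (T - 1) s0" for x
    using \<open>\<gamma> \<noteq> 0\<close> by simp
  then have "f s a - f' s a = D (T - 1) s0" for s a
    using last by metis
  then have "f' s a = f s a + - D (T - 1) s0" for s a
    by (simp add: algebra_simps)
  then show "\<exists>c. \<forall>s a. f' s a = f s a + c"
    by blast
qed

lemma relpowp_trans_add: "(P ^^ m) x y \<Longrightarrow> (P ^^ n) y z \<Longrightarrow> (P ^^ (m + n)) x z"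
  by (auto simp: relpowp_add)

lemma relpowp_loop_mult: "(P ^^ m) x x \<Longrightarrow> (P ^^ (m * k)) x x"
  by (induction k) (auto intro: relpowp_trans_add)

text \<open>The coin problem for two denominations: solving \<open>b * y = n\<close> modulo
  \<open>a\<close> with \<open>y < a\<close> keeps \<open>b * y\<close> at most
  \<open>a * b - b\<close>, hence at most \<open>n\<close>, and the rest is a multiple of
  \<open>a\<close>.\<close>

lemma coprime_nat_combination:
  fixes a b n :: nat
  assumes "coprime a b" and "0 < a" and "0 < b" and "a * b \<le> Suc n"
  obtains x y where "n = a * x + b * y"
proof -
  obtain z where "[b * z = 1] (mod a)"
    using cong_solve_coprime_nat[of b a] assms(1) by (auto simp: coprime_commute)
  then have "[b * (z * n) = n] (mod a)"
    using cong_scalar_right[of "b * z" 1 a n] by (simp add: mult.assoc)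
  moreover define y where "y = (z * n) mod a"
  ultimately have y: "[b * y = n] (mod a)"
    by (simp add: cong_def mod_mult_right_eq)
  have "Suc y \<le> a"
    using \<open>0 < a\<close> by (simp add: y_def Suc_le_eq)
  then have "b * Suc y \<le> a * b"
    by (metis mult.commute mult_le_mono2)
  then have "b * y \<le> n"
    using assms by simp
  then obtain x where "n = a * x + b * y"
    using y by (metis cong_le_nat cong_sym add.commute mult.commute)
  then show thesis by (rule that)
qed

text \<open>Cycles at \<open>s0\<close> are prepended to a path of length \<open>n \<le> d\<close>
  to pad it to a length common to all \<open>s\<close>. The padding is at least
  \<open>R * R' - 1\<close>, the threshold of the coin problem.\<close>

lemma coprime_cycles_exactly_accessible:
  assumes "cycle_at K s0 R" and "cycle_at K s0 R'" and "gcd R R' = 1"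
    and "all_accessible_within K s0 d"
  shows "(possible K ^^ (d + R * R' - 1)) s0 s"
proof -
  have pos: "0 < R" "0 < R'" and loops: "(possible K ^^ R) s0 s0" "(possible K ^^ R') s0 s0"
    using assms by (auto simp: cycle_at_def)
  obtain n where "n \<le> d" and n: "(possible K ^^ n) s0 s"
    using assms by (auto simp: all_accessible_within_def)
  define m where "m = d + R * R' - 1 - n"
  have "0 < R * R'"
    using pos by simp
  then have "R * R' \<le> Suc m" and m: "d + R * R' - 1 = m + n"
    using \<open>n \<le> d\<close> unfolding m_def by linarith+
  then obtain x y where "m = R * x + R' * y"
    using coprime_nat_combination pos assms(3) by (metis coprime_iff_gcd_eq_1)
  then have "(possible K ^^ m) s0 s0"
    using loops by (auto intro: relpowp_trans_add relpowp_loop_mult)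
  then show ?thesis
    unfolding m using n by (rule relpowp_trans_add)
qed

lemma well_posed_if_coprime_cycles:
  fixes K :: "'s::finite \<Rightarrow> 'a::finite \<Rightarrow> 's pmf"
  assumes "\<gamma> \<noteq> 0" and "lam \<noteq> 0" and "deterministic K"
    and "cycle_at K s0 R" and "cycle_at K s0 R'" and "gcd R R' = 1"
    and "all_accessible_within K s0 d" and "d + R * R' \<le> T"
  shows "IRL_well_posed K \<gamma> lam g T"
proof (rule well_posed_if_exactly_accessible)
  have "0 < R * R'"
    using assms by (simp add: cycle_at_def)
  then show "d + R * R' - 1 < T"
    using assms by linarith
  show "(possible K ^^ (d + R * R' - 1)) s0 s" for s
    using assms by (intro coprime_cycles_exactly_accessible)
qed (use assms in auto)

lemma cycle_at_add: "cycle_at K s m \<Longrightarrow> cycle_at K s n \<Longrightarrow> cycle_at K s (m + n)"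
  by (auto simp: cycle_at_def intro: relpowp_trans_add)

text \<open>A cycle at \<open>s\<close> can be spliced into a round trip from \<open>s0\<close>
  through \<open>s\<close>; \<open>m\<close> divides the lengths with and without it, hence their
  difference.\<close>

lemma irreducible_dvd_cycles:
  assumes "irreducible_chain K" and dvd: "\<And>n. cycle_at K s0 n \<Longrightarrow> m dvd n"
    and "cycle_at K s n"
  shows "m dvd n"
proof (cases "s = s0")
  case False
  obtain i j where i: "(possible K ^^ i) s0 s" and j: "(possible K ^^ j) s s0"
    using assms(1) unfolding irreducible_chain_def by blast
  \<comment> \<open>The bare round trip must be nonempty to count as a cycle.\<close>
  have "0 < i"
    using i False by (cases i) auto
  have "cycle_at K s0 (i + j)" "cycle_at K s0 (i + n + j)"
    using i j \<open>0 < i\<close> assms(3) by (auto simp: cycle_at_def intro: relpowp_trans_add)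
  then have "m dvd i + j" "m dvd (i + j) + n"
    using dvd by (simp_all add: ac_simps)
  then show ?thesis
    by (simp add: dvd_add_right_iff)
qed (use assms in blast)

text \<open>As in Euclid's algorithm, the least positive difference \<open>e\<close> of cycle
  lengths at \<open>s0\<close> divides all of them, since a nonzero remainder would be a smaller
  difference. Aperiodicity then forces \<open>e = 1\<close>.\<close>

lemma aperiodic_consecutive_cycles:
  assumes irr: "irreducible_chain K" and aper: "aperiodic_chain K"
  obtains m where "cycle_at K s0 m" and "cycle_at K s0 (Suc m)"
proof -
  have no_divisor: "\<exists>n. cycle_at K s0 n \<and> \<not> m dvd n" if "1 < m" for m
    using irreducible_dvd_cycles[OF irr] aper that unfolding aperiodic_chain_def by metis
  define gap where "gap e \<longleftrightarrow> 0 < e \<and> (\<exists>l. cycle_at K s0 l \<and> cycle_at K s0 (l + e))" for e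
  \<comment> \<open>Compare the cycle with its double traversal.\<close>
  have gap_cycle: "gap n" if "cycle_at K s0 n" for n
    using that cycle_at_add[OF that that] by (auto simp: gap_def cycle_at_def)
  obtain n where "cycle_at K s0 n"
    using no_divisor[of 2] by auto
  then have "\<exists>e. gap e"
    using gap_cycle by blast
  define e where "e = (LEAST e. gap e)"
  have "gap e"
    unfolding e_def using \<open>\<exists>e. gap e\<close> by (rule LeastI_ex)
  have least: "\<not> gap r" if "r < e" for r
    using that unfolding e_def by (rule not_less_Least)
  obtain l where "0 < e" and l: "cycle_at K s0 l" "cycle_at K s0 (l + e)"
    using \<open>gap e\<close> by (auto simp: gap_def)
  have multiple: "cycle_at K s0 (k * Suc q)" if "cycle_at K s0 k" for k q
    using that by (induction q) (auto intro: cycle_at_add)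
  have "e dvd n" if n: "cycle_at K s0 n" for n
  proof (rule ccontr)
    assume "\<not> e dvd n"
    then have r: "0 < n mod e" "n mod e < e"
      using \<open>0 < e\<close> by (auto simp: dvd_eq_mod_eq_0)
    \<comment> \<open>For quotient \<open>Suc q\<close>, the cycle lengths
      \<open>l * Suc q + n\<close> and \<open>(l + e) * Suc q\<close> differ by the remainder.
      Quotient 0 is separate because length 0 is no cycle.\<close>
    have "gap (n mod e)"
    proof (cases "n div e")
      case 0
      then have "n mod e = n"
        using \<open>0 < e\<close> by (simp add: div_eq_0_iff)
      then show ?thesis
        using gap_cycle[OF n] by simp
    next
      case (Suc q)
      have "n = e * Suc q + n mod e"
        using mult_div_mod_eq[of e n] Suc by simp
      then have "(l + e) * Suc q + n mod e = l * Suc q + n"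
        by (simp only: add_mult_distrib)
      then show ?thesis
        using r(1) multiple[OF l(2), of q] cycle_at_add[OF multiple[OF l(1), of q] n]
        unfolding gap_def by metis
    qed
    then show False
      using least r(2) by blast
  qed
  then have "e = 1"
    using no_divisor[of e] \<open>0 < e\<close> by force
  then show thesis
    using l that by simp
qed

lemma irreducible_all_accessible_within:
  fixes K :: "'s::finite \<Rightarrow> 'a \<Rightarrow> 's pmf"
  assumes "irreducible_chain K"
  obtains d where "all_accessible_within K s0 d"
proof -
  obtain n where "(possible K ^^ n s) s0 s" for s
    using assms unfolding irreducible_chain_def by metis
  then have "all_accessible_within K s0 (Max (range n))"
    unfolding all_accessible_within_def by (meson Max_ge finite finite_imageI rangeI)
  then show thesis by (rule that)
qed

theorem corollary1:
  fixes K :: "'s::finite \<Rightarrow> 'a::finite \<Rightarrow> 's pmf"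
    and \<gamma> lam :: real
    and g :: "'s \<Rightarrow> real"
    and s0 :: 's
    and d R R' :: nat
  assumes "0 < \<gamma>" and "\<gamma> \<le> 1" and "0 < lam"
    and "deterministic K"
    and "(irreducible_chain K \<and> aperiodic_chain K)
       \<or> (possible K s0 s0 \<and> all_accessible_within K s0 d)
       \<or> (cycle_at K s0 R \<and> cycle_at K s0 R' \<and> gcd R R' = 1 \<and> all_accessible_within K s0 d)"
  shows "(\<exists>T. IRL_well_posed K \<gamma> lam g T)
       \<and> (possible K s0 s0 \<and> all_accessible_within K s0 d
            \<longrightarrow> (\<forall>T \<ge> d + 1. IRL_well_posed K \<gamma> lam g T))
       \<and> (cycle_at K s0 R \<and> cycle_at K s0 R' \<and> gcd R R' = 1 \<and> all_accessible_within K s0 d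
            \<longrightarrow> (\<forall>T \<ge> d + R * R'. IRL_well_posed K \<gamma> lam g T))"
proof -
  have "\<gamma> \<noteq> 0" "lam \<noteq> 0"
    using assms by auto
  note well_posed = well_posed_if_coprime_cycles[OF this \<open>deterministic K\<close>]
  have loop: "\<forall>T \<ge> d + 1. IRL_well_posed K \<gamma> lam g T"
    if "possible K s0 s0 \<and> all_accessible_within K s0 d"
    using well_posed[of s0 1 1 d] that by (simp add: cycle_at_def eq_OO)
  have cycles: "\<forall>T \<ge> d + R * R'. IRL_well_posed K \<gamma> lam g T"
    if "cycle_at K s0 R \<and> cycle_at K s0 R' \<and> gcd R R' = 1 \<and> all_accessible_within K s0 d"
    using well_posed[of s0 R R' d] that by simp
  have "\<exists>T. IRL_well_posed K \<gamma> lam g T" if "irreducible_chain K" "aperiodic_chain K"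
  proof -
    obtain m where "cycle_at K s0 m" "cycle_at K s0 (Suc m)"
      by (rule aperiodic_consecutive_cycles[OF \<open>irreducible_chain K\<close> \<open>aperiodic_chain K\<close>])
    moreover obtain d' where "all_accessible_within K s0 d'"
      by (rule irreducible_all_accessible_within[OF \<open>irreducible_chain K\<close>])
    \<comment> \<open>Consecutive numbers are coprime, so \<open>m\<close> and \<open>Suc m\<close>
      serve as the two cycle lengths.\<close>
    ultimately show ?thesis
      using well_posed[of s0 m "Suc m" d' "d' + m * Suc m"]
      by (metis order_refl coprime_Suc_right_nat coprime_iff_gcd_eq_1)
  qed
  then show ?thesis
    using loop cycles assms(5) by blast
qed

end
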